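(* Let $k$ be a positive integer. For every two $k\times k$ (real) matrices $A,B$, $$\hat{\hat{\delta}}_2(A,B)\ \le\ \delta_2(W[A],W[B]).$$
   Context: For a $k\times k$ matrix $M$, $W[M]$ is the block function on $[0,1]^2$ with blocks $I_i=(\frac{i-1}{k},\frac ik]$, $i=1,\dots,k$, taking the value $M_{ij}$ on $I_i\times I_j$ (the point $0$ may be adjoined to $I_1$; this null set is irrelevant). For a $k\times k$ matrix $A$, $\|A\|_2=\big(\frac1{k^2}\sum_{i,j=1}^k A_{ij}^2\big)^{1/2}$ (normalized so that $\|A\|_2=\|W[A]\|_{L_2([0,1]^2)}$). For permutations $\sigma,\tau\in\mathcal{S}_k$, $A_{\sigma,\tau}$ is the $k\times k$ matrix with entries $(A_{\sigma,\tau})_{ij}=A_{\sigma(i),\tau(j)}$, and $$\hat{\hat{\delta}}_2(A,B)=\min_{\sigma,\tau\in\mathcal{S}_k}\|A_{\sigma,\tau}-B\|_2 .$$ For functions $W,W'$ on $[0,1]^2$, $\delta_2(W,W')=\inf_\phi\|W_\phi-W'\|_2$, where $\phi$ ranges over all measurable measure-preserving maps $[0,1]\to[0,1]$ (Lebesgue measure), $W_\phi(x,y)=W(\phi(x),\phi(y))$, and $\|\cdot\|_2$ is the $L_2$ norm on $[0,1]^2$. *)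

theory Defs
  imports "HOL-Analysis.Analysis"
begin

text \<open>
  A real \<open>k \<times> k\<close> matrix is a function \<open>nat \<Rightarrow> nat \<Rightarrow> real\<close> of which only the
  entries with both indices in \<open>{1..k}\<close> are ever used.
\<close>

text \<open>The point \<open>0\<close> is adjoined to the first block, so that the blocks partition \<open>[0,1]\<close>.\<close>

definition block :: "nat \<Rightarrow> nat \<Rightarrow> real set" where
  "block k i = {(real i - 1) / real k <.. real i / real k} \<union> (if i = 1 then {0} else {})"

definition block_function :: "nat \<Rightarrow> (nat \<Rightarrow> nat \<Rightarrow> real) \<Rightarrow> real \<Rightarrow> real \<Rightarrow> real" where
  "block_function k M x y =
     (\<Sum>i=1..k. \<Sum>j=1..k. M i j * indicator (block k i) x * indicator (block k j) y)"

definition matrix_norm2 :: "nat \<Rightarrow> (nat \<Rightarrow> nat \<Rightarrow> real) \<Rightarrow> real" where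
  "matrix_norm2 k A = sqrt (1 / (real k)\<^sup>2 * (\<Sum>i=1..k. \<Sum>j=1..k. (A i j)\<^sup>2))"

definition permute_matrix ::
    "(nat \<Rightarrow> nat) \<Rightarrow> (nat \<Rightarrow> nat) \<Rightarrow> (nat \<Rightarrow> nat \<Rightarrow> real) \<Rightarrow> nat \<Rightarrow> nat \<Rightarrow> real" where
  "permute_matrix \<sigma> \<tau> A i j = A (\<sigma> i) (\<tau> j)"

definition delta2_hat_hat :: "nat \<Rightarrow> (nat \<Rightarrow> nat \<Rightarrow> real) \<Rightarrow> (nat \<Rightarrow> nat \<Rightarrow> real) \<Rightarrow> real" where
  "delta2_hat_hat k A B =
     Min {matrix_norm2 k (\<lambda>i j. permute_matrix \<sigma> \<tau> A i j - B i j) | \<sigma> \<tau>.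
            \<sigma> permutes {1..k} \<and> \<tau> permutes {1..k}}"

text \<open>
  The \<open>L\<^sub>2\<close> norm on \<open>[0,1]\<^sup>2\<close>.  The Bochner integral is \<open>0\<close> when the square of \<open>f\<close> is not
  integrable, so the value is meaningful only for square-integrable \<open>f\<close>
  (in particular for bounded measurable \<open>f\<close>).
\<close>

definition L2_norm_square :: "(real \<Rightarrow> real \<Rightarrow> real) \<Rightarrow> real" where
  "L2_norm_square f =
     sqrt (integral\<^sup>L (lebesgue_on ({0..1} \<times> {0..1})) (\<lambda>(x, y). (f x y)\<^sup>2))"

text \<open>
  Measurability is with respect to the Lebesgue measurable sets on both sides.  A
  measure-preserving map that is only measurable from Lebesgue sets to Borel sets is
  automatically of this kind, by completeness.  Maps need not be bijective, and values
  outside \<open>[0,1]\<close> are irrelevant.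
\<close>

definition measure_preserving_unit :: "(real \<Rightarrow> real) \<Rightarrow> bool" where
  "measure_preserving_unit \<phi> \<longleftrightarrow>
     \<phi> \<in> measurable (lebesgue_on {0..1}) (lebesgue_on {0..1}) \<and>
     (\<forall>S \<in> sets (lebesgue_on {0..1}).
        emeasure (lebesgue_on {0..1}) (\<phi> -` S \<inter> {0..1}) = emeasure (lebesgue_on {0..1}) S)"

definition relabel :: "(real \<Rightarrow> real) \<Rightarrow> (real \<Rightarrow> real \<Rightarrow> real) \<Rightarrow> real \<Rightarrow> real \<Rightarrow> real" where
  "relabel \<phi> W x y = W (\<phi> x) (\<phi> y)"

definition delta2 :: "(real \<Rightarrow> real \<Rightarrow> real) \<Rightarrow> (real \<Rightarrow> real \<Rightarrow> real) \<Rightarrow> real" where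
  "delta2 W W' =
     (INF \<phi> \<in> {\<phi>. measure_preserving_unit \<phi>}. L2_norm_square (\<lambda>x y. relabel \<phi> W x y - W' x y))"

text \<open>
  The minimum is over a finite nonempty set and the infimum over a nonempty set that is
  bounded below, so \<open>Min\<close> and \<open>INF\<close> have their usual meaning.
\<close>

lemma delta2_hat_hat_set:
  fixes k :: nat and A B :: "nat \<Rightarrow> nat \<Rightarrow> real"
  defines "S \<equiv> {matrix_norm2 k (\<lambda>i j. permute_matrix \<sigma> \<tau> A i j - B i j) | \<sigma> \<tau>.
                   \<sigma> permutes {1..k} \<and> \<tau> permutes {1..k}}"
  shows "finite S" "S \<noteq> {}"
proof -
  have "S = (\<lambda>(\<sigma>, \<tau>). matrix_norm2 k (\<lambda>i j. permute_matrix \<sigma> \<tau> A i j - B i j)) `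
              ({\<sigma>. \<sigma> permutes {1..k}} \<times> {\<tau>. \<tau> permutes {1..k}})"
    unfolding S_def by auto
  then show "finite S" by (simp add: finite_permutations)
  show "S \<noteq> {}" unfolding S_def using permutes_id by blast
qed

lemma measure_preserving_unit_id: "measure_preserving_unit (\<lambda>x. x)"
proof -
  have "S \<inter> {0..1} = S" if "S \<in> sets (lebesgue_on {0..1})" for S :: "real set"
    using sets.sets_into_space[OF that] by auto
  then show ?thesis
    unfolding measure_preserving_unit_def by (simp add: measurable_ident_sets)
qed

lemma delta2_bdd_below:
  "bdd_below ((\<lambda>\<phi>. L2_norm_square (\<lambda>x y. relabel \<phi> W x y - W' x y)) ` {\<phi>. measure_preserving_unit \<phi>})"
proof (rule bdd_belowI2)
  fix \<phi> :: "real \<Rightarrow> real"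
  show "0 \<le> L2_norm_square (\<lambda>x y. relabel \<phi> W x y - W' x y)"
    unfolding L2_norm_square_def case_prod_unfold
    by (intro real_sqrt_ge_zero Bochner_Integration.integral_nonneg zero_le_power2)
qed

lemma block_unique:
  assumes "x \<in> block k i" "x \<in> block k i'" "i \<in> {1..k}" "i' \<in> {1..k}"
  shows "i = i'"
proof -
  have k: "real k > 0" using assms(3) by simp
  have mem: "(real i - 1 < x * real k \<or> i = 1) \<and> x * real k \<le> real i"
    if "x \<in> block k i" "i \<in> {1..k}" for i
    using that k by (cases "i = 1") (auto simp: block_def divide_less_eq le_divide_eq)
  have "i \<le> i'" if "i \<in> {1..k}" "i' \<in> {1..k}" "x \<in> block k i" "x \<in> block k i'" for i i'
  proof (cases "i = 1")
    case True
    then show ?thesis using that(2) by simp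
  next
    case False
    then have "real i - 1 < real i'" using mem[OF that(3,1)] mem[OF that(4,2)] by linarith
    then show ?thesis by linarith
  qed
  from this[OF assms(3,4,1,2)] this[OF assms(4,3,2,1)] show ?thesis by (rule le_antisym)
qed

lemma block_function_eq:
  assumes "i \<in> {1..k}" "j \<in> {1..k}" "x \<in> block k i" "y \<in> block k j"
  shows "block_function k M x y = M i j"
proof -
  have x: "indicator (block k i') x = (if i' = i then 1 else 0 :: real)" if "i' \<in> {1..k}" for i'
    using block_unique[OF _ assms(3) that assms(1)] assms(3) by (metis indicator_simps)
  have y: "indicator (block k j') y = (if j' = j then 1 else 0 :: real)" if "j' \<in> {1..k}" for j'
    using block_unique[OF _ assms(4) that assms(2)] assms(4) by (metis indicator_simps)
  have "block_function k M x y =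
          (\<Sum>i'=1..k. \<Sum>j'=1..k. if i' = i then if j' = j then M i' j' else 0 else 0)"
    unfolding block_function_def by (intro sum.cong refl) (auto simp: x y)
  also have "\<dots> = (\<Sum>i'=1..k. if i' = i then M i j else 0)"
    using assms(2) by (intro sum.cong refl) auto
  also have "\<dots> = M i j" using assms(1) by simp
  finally show ?thesis .
qed

end

theory Submission
  imports Defs
begin

text \<open>
  For a measure-preserving \<open>\<phi>\<close> let \<open>P i j\<close> be the measure of the set of those \<open>x\<close> in the \<open>j\<close>-th
  block that \<open>\<phi>\<close> maps into the \<open>i\<close>-th block. Every block has measure \<open>1/k\<close> and \<open>\<phi>\<close> preserves
  measure, so all rows and columns of \<open>P\<close> sum to \<open>1/k\<close> (sum_measure_overlap). Both \<open>x\<close> and \<open>y\<close>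
  are distributed in this way, and independently of each other, whence
  (L2_norm_square_block_diff) the squared distance between the block function of \<open>B\<close> and the
  relabelled block function of \<open>A\<close> is
  \<open>\<Sum>j' i' j i. (A i i' - B j j')\<^sup>2 * P i j * P i' j'\<close>.

  This is a quadratic form in \<open>P\<close>, but it may be read as a bilinear form whose two arguments
  coincide. With either argument held fixed the form is linear in the other, and a
  linear function on the nonnegative matrices with these row and column sums is at least its
  smallest value at \<open>1/k\<close> times a permutation matrix (exists_permutation_below_average, the consequence of the
  Birkhoff--von Neumann theorem that is used here). Replacing the two copies of \<open>P\<close> one
  after the other by such matrices thus never increases the form, and it ends at the squared
  norm of \<open>A\<close> permuted minus \<open>B\<close>. The two permutations are found separately and have no
  reason to agree, which is why rows and columns of \<open>A\<close> are permuted independently.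
\<close>

section \<open>Assignments and doubly stochastic matrices\<close>

text \<open>
  The induction of Halmos and Vaughan. If some nonempty proper subfamily \<open>J\<close> has exactly
  \<open>card J\<close> candidates, these have to be spent on \<open>J\<close>, and Hall's condition survives on the rest
  once they are removed. Otherwise every nonempty proper subfamily has a candidate to spare,
  so one index may be given any of its candidates.
\<close>

theorem hall_marriage:
  assumes "finite I" and "\<And>i. i \<in> I \<Longrightarrow> finite (F i)"
    and "\<And>J. J \<subseteq> I \<Longrightarrow> card J \<le> card (\<Union>(F ` J))"
  shows "\<exists>f. inj_on f I \<and> (\<forall>i\<in>I. f i \<in> F i)"
  using assms
proof (induction I arbitrary: F rule: finite_psubset_induct)
  case (psubset I)
  have fin: "finite (\<Union>(F ` J))" if "J \<subseteq> I" for J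
    using that psubset.hyps psubset.prems(1) by (meson finite_UN finite_subset subsetD)
  have finI: "finite J" if "J \<subseteq> I" for J
    using that psubset.hyps finite_subset by blast
  consider (empty) "I = {}"
    | (tight) J where "J \<subset> I" "J \<noteq> {}" "card (\<Union>(F ` J)) \<le> card J"
    | (slack) "I \<noteq> {}" "\<And>J. J \<subset> I \<Longrightarrow> J \<noteq> {} \<Longrightarrow> card J < card (\<Union>(F ` J))"
    by (meson not_less)
  then show ?case
  proof cases
    case empty
    then show ?thesis by simp
  next
    case (tight J)
    define U where "U = \<Union>(F ` J)"
    have finU: "finite U" unfolding U_def using fin tight(1) by blast
    have "\<exists>f. inj_on f J \<and> (\<forall>i\<in>J. f i \<in> F i)"
      using tight(1) by (intro psubset.IH) (use psubset.prems in auto)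
    then obtain f where f: "inj_on f J" "\<forall>i\<in>J. f i \<in> F i" by blast
    have "\<exists>g. inj_on g (I - J) \<and> (\<forall>i\<in>I - J. g i \<in> F i - U)"
    proof (rule psubset.IH)
      show "I - J \<subset> I" using tight by auto
      show "finite (F i - U)" if "i \<in> I - J" for i using that psubset.prems(1) by auto
      fix K assume K: "K \<subseteq> I - J"
      have "card K + card J = card (K \<union> J)"
        using K tight(1) by (intro card_Un_disjoint[symmetric] finI) auto
      also have "\<dots> \<le> card (\<Union>(F ` (K \<union> J)))"
        using K tight(1) by (intro psubset.prems(2)) auto
      also have "\<Union>(F ` (K \<union> J)) = (\<Union>i\<in>K. F i - U) \<union> U"
        unfolding U_def by auto
      also have "card \<dots> \<le> card (\<Union>i\<in>K. F i - U) + card U"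
        by (rule card_Un_le)
      also have "card U \<le> card J" using tight(3) unfolding U_def .
      finally show "card K \<le> card (\<Union>i\<in>K. F i - U)" by simp
    qed
    then obtain g where g: "inj_on g (I - J)" "\<forall>i\<in>I - J. g i \<in> F i - U" by blast
    have "inj_on (\<lambda>i. if i \<in> J then f i else g i) I"
      using f g unfolding inj_on_def U_def by (metis DiffI DiffD2 UN_I)
    moreover have "\<forall>i\<in>I. (if i \<in> J then f i else g i) \<in> F i"
      using f g by auto
    ultimately show ?thesis by (intro exI[of _ "\<lambda>i. if i \<in> J then f i else g i"]) blast
  next
    case slack
    obtain a where a: "a \<in> I" using slack(1) by blast
    have "F a \<noteq> {}" using psubset.prems(2)[of "{a}"] a by auto
    then obtain y where y: "y \<in> F a" by blast
    have "\<exists>g. inj_on g (I - {a}) \<and> (\<forall>i\<in>I - {a}. g i \<in> F i - {y})"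
    proof (rule psubset.IH)
      show "I - {a} \<subset> I" using a by auto
      show "finite (F i - {y})" if "i \<in> I - {a}" for i using that psubset.prems(1) by auto
      fix K assume K: "K \<subseteq> I - {a}"
      show "card K \<le> card (\<Union>i\<in>K. F i - {y})"
      proof (cases "K = {}")
        case False
        then have "card K < card (\<Union>(F ` K))" using K a by (intro slack(2)) auto
        also have "\<Union>(F ` K) \<subseteq> insert y (\<Union>i\<in>K. F i - {y})" by auto
        then have "card (\<Union>(F ` K)) \<le> card (insert y (\<Union>i\<in>K. F i - {y}))"
          using K finI[of K] psubset.prems(1) by (intro card_mono) (auto simp: subset_iff)
        also have "\<dots> \<le> Suc (card (\<Union>i\<in>K. F i - {y}))"
          using K finI[of K] psubset.prems(1) by (subst card_insert_if) (auto simp: subset_iff)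
        finally show ?thesis by simp
      qed simp
    qed
    then obtain g where g: "inj_on g (I - {a})" "\<forall>i\<in>I - {a}. g i \<in> F i - {y}" by blast
    have "inj_on (g(a := y)) I"
      using g unfolding inj_on_def by (auto simp: fun_upd_def)
    moreover have "\<forall>i\<in>I. (g(a := y)) i \<in> F i" using g y by auto
    ultimately show ?thesis by blast
  qed
qed

text \<open>
  Hall's condition holds for the supports of the columns because the columns in \<open>J\<close>
  carry the total mass \<open>s * card J\<close>, all of it in rows that meet their support, and
  each row has room for \<open>s\<close> only.
\<close>

lemma permutation_in_support:
  fixes P :: "'a \<Rightarrow> 'a \<Rightarrow> real"
  assumes fin: "finite X" and nonneg: "\<And>i j. i \<in> X \<Longrightarrow> j \<in> X \<Longrightarrow> 0 \<le> P i j"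
    and row: "\<And>i. i \<in> X \<Longrightarrow> (\<Sum>j\<in>X. P i j) = s"
    and col: "\<And>j. j \<in> X \<Longrightarrow> (\<Sum>i\<in>X. P i j) = s"
    and "s > 0"
  shows "\<exists>\<sigma>. \<sigma> permutes X \<and> (\<forall>j\<in>X. 0 < P (\<sigma> j) j)"
proof -
  define F where "F j = {i\<in>X. 0 < P i j}" for j
  have "\<exists>f. inj_on f X \<and> (\<forall>j\<in>X. f j \<in> F j)"
  proof (rule hall_marriage)
    fix J assume J: "J \<subseteq> X"
    define N where "N = \<Union>(F ` J)"
    have N: "N \<subseteq> X" unfolding N_def F_def by auto
    have "s * card J = (\<Sum>j\<in>J. \<Sum>i\<in>X. P i j)"
      using J col by (simp add: subset_iff)
    also have "\<dots> = (\<Sum>j\<in>J. \<Sum>i\<in>N. P i j)"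
    proof (rule sum.cong)
      fix j assume j: "j \<in> J"
      have "P i j = 0" if "i \<in> X - N" for i
        using that j J nonneg[of i j] unfolding N_def F_def by force
      then show "(\<Sum>i\<in>X. P i j) = (\<Sum>i\<in>N. P i j)"
        by (intro sum.mono_neutral_right fin N) blast
    qed simp
    also have "\<dots> = (\<Sum>i\<in>N. \<Sum>j\<in>J. P i j)" by (rule sum.swap)
    also have "\<dots> \<le> (\<Sum>i\<in>N. \<Sum>j\<in>X. P i j)"
      using N J nonneg fin by (intro sum_mono sum_mono2) auto
    also have "\<dots> = s * card N" using N row by (simp add: subset_iff)
    finally show "card J \<le> card (\<Union>(F ` J))" using \<open>s > 0\<close> unfolding N_def by simp
  qed (use fin in \<open>auto simp: F_def\<close>)
  then obtain f where f: "inj_on f X" "\<forall>j\<in>X. f j \<in> F j" by blast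
  define \<sigma> where "\<sigma> j = (if j \<in> X then f j else j)" for j
  have "\<sigma> permutes X"
  proof (rule inj_imp_permutes[OF _ fin])
    show "inj_on \<sigma> X" using f(1) by (simp add: inj_on_def \<sigma>_def)
  qed (use f(2) in \<open>auto simp: \<sigma>_def F_def\<close>)
  moreover have "\<forall>j\<in>X. 0 < P (\<sigma> j) j" using f(2) by (auto simp: \<sigma>_def F_def)
  ultimately show ?thesis by blast
qed

text \<open>
  The greedy proof of the Birkhoff--von Neumann theorem, run directly on the cost. Subtracting
  from \<open>P\<close> the largest possible multiple \<open>t\<close> of a permutation matrix inside its support keeps all
  row and column sums equal and makes a further entry vanish, while the cost drops by at least
  \<open>t * m\<close>. The common sum \<open>s\<close> is a parameter because it decreases to \<open>s - t\<close>.
\<close>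

lemma assignment_cost_lower_bound:
  fixes P c :: "'a \<Rightarrow> 'a \<Rightarrow> real"
  assumes fin: "finite X" and "\<And>i j. i \<in> X \<Longrightarrow> j \<in> X \<Longrightarrow> 0 \<le> P i j"
    and "\<And>i. i \<in> X \<Longrightarrow> (\<Sum>j\<in>X. P i j) = s"
    and "\<And>j. j \<in> X \<Longrightarrow> (\<Sum>i\<in>X. P i j) = s"
    and "s \<ge> 0"
    and m: "\<And>\<sigma>. \<sigma> permutes X \<Longrightarrow> m \<le> (\<Sum>j\<in>X. c (\<sigma> j) j)"
  shows "s * m \<le> (\<Sum>j\<in>X. \<Sum>i\<in>X. c i j * P i j)"
  using assms(2-5)
proof (induction "card {(i, j). i \<in> X \<and> j \<in> X \<and> P i j \<noteq> 0}" arbitrary: P s rule: less_induct)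
  case less
  show ?case
  proof (cases "s = 0 \<or> X = {}")
    case True
    have "P i j = 0" if "i \<in> X" "j \<in> X" for i j
      using less.prems(1,2)[OF that(1)] that True fin by (auto simp: sum_nonneg_eq_0_iff)
    then show ?thesis using True m[OF permutes_id] \<open>s \<ge> 0\<close>
      by (auto simp: mult_nonneg_nonpos)
  next
    case False
    then have "s > 0" using less.prems(4) by simp
    then obtain \<sigma> where \<sigma>: "\<sigma> permutes X" "\<And>j. j \<in> X \<Longrightarrow> 0 < P (\<sigma> j) j"
      using permutation_in_support[OF fin less.prems(1-3)] by blast
    have \<sigma>X: "\<sigma> j \<in> X" if "j \<in> X" for j using that \<sigma>(1) by (simp add: permutes_in_image)
    define t where "t = Min ((\<lambda>j. P (\<sigma> j) j) ` X)"
    have t_le: "t \<le> P (\<sigma> j) j" if "j \<in> X" for j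
      unfolding t_def using that fin by (intro Min_le) auto
    have "t \<in> (\<lambda>j. P (\<sigma> j) j) ` X"
      unfolding t_def using fin False by (intro Min_in) auto
    then obtain b where b: "b \<in> X" "t = P (\<sigma> b) b" by blast
    have "t > 0" using b \<sigma>(2) by simp
    define Q where "Q i j = P i j - (if i = \<sigma> j then t else 0)" for i j
    have inv: "i = \<sigma> j \<longleftrightarrow> inv \<sigma> i = j" for i j
      using \<sigma>(1) by (metis permutes_inv_eq)
    have invX: "inv \<sigma> i \<in> X" if "i \<in> X" for i
      using that permutes_inv[OF \<sigma>(1)] by (simp add: permutes_in_image)
    have row: "(\<Sum>j\<in>X. Q i j) = s - t" if "i \<in> X" for i
      using that fin invX[OF that] less.prems(2)[OF that]
      by (simp add: Q_def sum_subtractf inv)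
    have col: "(\<Sum>i\<in>X. Q i j) = s - t" if "j \<in> X" for j
      using that fin \<sigma>X[OF that] less.prems(3)[OF that]
      by (simp add: Q_def sum_subtractf)
    have Q_nonneg: "0 \<le> Q i j" if "i \<in> X" "j \<in> X" for i j
      using that less.prems(1) t_le by (auto simp: Q_def)
    have "0 \<le> s - t"
      using row[OF b(1)] Q_nonneg[OF b(1)] sum_nonneg[of X "Q b"] by simp
    have "(s - t) * m \<le> (\<Sum>j\<in>X. \<Sum>i\<in>X. c i j * Q i j)"
    proof (rule less.hyps)
      have "{(i, j). i \<in> X \<and> j \<in> X \<and> Q i j \<noteq> 0} \<subset> {(i, j). i \<in> X \<and> j \<in> X \<and> P i j \<noteq> 0}"
      proof (rule psubsetI)
        show "{(i, j). i \<in> X \<and> j \<in> X \<and> Q i j \<noteq> 0} \<subseteq> {(i, j). i \<in> X \<and> j \<in> X \<and> P i j \<noteq> 0}"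
          using \<sigma>(2) less_irrefl by (fastforce simp: Q_def split: if_splits)
        have "(\<sigma> b, b) \<in> {(i, j). i \<in> X \<and> j \<in> X \<and> P i j \<noteq> 0}"
          using b \<open>t > 0\<close> \<sigma>X by auto
        moreover have "(\<sigma> b, b) \<notin> {(i, j). i \<in> X \<and> j \<in> X \<and> Q i j \<noteq> 0}"
          using b by (simp add: Q_def)
        ultimately show "{(i, j). i \<in> X \<and> j \<in> X \<and> Q i j \<noteq> 0} \<noteq> {(i, j). i \<in> X \<and> j \<in> X \<and> P i j \<noteq> 0}"
          by blast
      qed
      then show "card {(i, j). i \<in> X \<and> j \<in> X \<and> Q i j \<noteq> 0} < card {(i, j). i \<in> X \<and> j \<in> X \<and> P i j \<noteq> 0}"
        by (rule psubset_card_mono[rotated])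
           (rule finite_subset[of _ "X \<times> X"], use fin in auto)
    qed (use Q_nonneg row col \<open>0 \<le> s - t\<close> in auto)
    moreover have "t * m \<le> t * (\<Sum>j\<in>X. c (\<sigma> j) j)"
      using m[OF \<sigma>(1)] \<open>t > 0\<close> by simp
    moreover have "(\<Sum>i\<in>X. c i j * P i j) = (\<Sum>i\<in>X. c i j * Q i j) + t * c (\<sigma> j) j"
      if "j \<in> X" for j
    proof -
      have "(\<Sum>i\<in>X. c i j * P i j) = (\<Sum>i\<in>X. c i j * Q i j + (if i = \<sigma> j then t * c i j else 0))"
        by (intro sum.cong) (auto simp: Q_def algebra_simps)
      then show ?thesis using \<sigma>X[OF that] fin by (simp add: sum.distrib)
    qed
    then have "(\<Sum>j\<in>X. \<Sum>i\<in>X. c i j * P i j) =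
        (\<Sum>j\<in>X. \<Sum>i\<in>X. c i j * Q i j) + t * (\<Sum>j\<in>X. c (\<sigma> j) j)"
      by (simp add: sum.distrib sum_distrib_left)
    ultimately show ?thesis by (simp add: algebra_simps)
  qed
qed

lemma exists_permutation_below_average:
  fixes P c :: "'a \<Rightarrow> 'a \<Rightarrow> real"
  assumes "finite X" and "\<And>i j. i \<in> X \<Longrightarrow> j \<in> X \<Longrightarrow> 0 \<le> P i j"
    and "\<And>i. i \<in> X \<Longrightarrow> (\<Sum>j\<in>X. P i j) = s"
    and "\<And>j. j \<in> X \<Longrightarrow> (\<Sum>i\<in>X. P i j) = s"
    and "s \<ge> 0"
  shows "\<exists>\<sigma>. \<sigma> permutes X \<and> s * (\<Sum>j\<in>X. c (\<sigma> j) j) \<le> (\<Sum>j\<in>X. \<Sum>i\<in>X. c i j * P i j)"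
proof -
  let ?C = "(\<lambda>\<sigma>. \<Sum>j\<in>X. c (\<sigma> j) j) ` {\<sigma>. \<sigma> permutes X}"
  have C: "finite ?C" "?C \<noteq> {}"
    using assms(1) permutes_id[of X] by (auto simp: finite_permutations simp del: permutes_id)
  obtain \<sigma> where \<sigma>: "\<sigma> permutes X" "Min ?C = (\<Sum>j\<in>X. c (\<sigma> j) j)"
    using Min_in[OF C] by auto
  have "s * Min ?C \<le> (\<Sum>j\<in>X. \<Sum>i\<in>X. c i j * P i j)"
    using C by (intro assignment_cost_lower_bound assms) auto
  then show ?thesis using \<sigma> by auto
qed

section \<open>Lebesgue measure of rectangles\<close>

text \<open>
  The preimages of blocks are Lebesgue sets and need not be Borel, whereas the product measure
  of \<open>lborel\<close> with itself gives the measure of Borel rectangles only. Up to a null set, the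
  rectangle is the product of the Borel main parts of its sides.
\<close>

lemma
  fixes S T :: "real set"
  assumes "S \<in> sets lebesgue" "T \<in> sets lebesgue"
  shows sets_lebesgue_Times: "S \<times> T \<in> sets lebesgue"
    and emeasure_lebesgue_Times:
      "emeasure lebesgue (S \<times> T) = emeasure lebesgue S * emeasure lebesgue T"
proof -
  define S0 T0 where "S0 = main_part lborel S" and "T0 = main_part lborel T"
  have S0: "S0 \<in> sets borel" "S0 \<subseteq> S" and T0: "T0 \<in> sets borel" "T0 \<subseteq> T"
    using main_part_sets[of S lborel] main_part_sets[of T lborel]
      main_part_null_part_Un[of S lborel] main_part_null_part_Un[of T lborel] assms
    unfolding S0_def T0_def sets_lborel by blast+
  obtain N where N: "N \<in> null_sets lborel" "null_part lborel S \<subseteq> N"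
    using null_part assms(1) by blast
  obtain M where M: "M \<in> null_sets lborel" "null_part lborel T \<subseteq> M"
    using null_part assms(2) by blast
  have null_rect: "N \<times> UNIV \<in> null_sets (lborel \<Otimes>\<^sub>M lborel)"
    if "N \<in> null_sets lborel" for N :: "real set"
    using that by (auto simp: null_sets_def lborel.emeasure_pair_measure_Times)
  have null_rect': "UNIV \<times> M \<in> null_sets (lborel \<Otimes>\<^sub>M lborel)"
    if "M \<in> null_sets lborel" for M :: "real set"
    using that by (auto simp: null_sets_def lborel.emeasure_pair_measure_Times)
  have "N \<times> UNIV \<union> UNIV \<times> M \<in> null_sets lborel"
    using null_rect[OF N(1)] null_rect'[OF M(1)] unfolding lborel_prod by (rule null_sets.Un)
  moreover have "S \<times> T - S0 \<times> T0 \<subseteq> N \<times> UNIV \<union> UNIV \<times> M"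
    using N(2) M(2) main_part_null_part_Un[of S lborel] main_part_null_part_Un[of T lborel] assms
    unfolding S0_def T0_def by blast
  ultimately have null: "S \<times> T - S0 \<times> T0 \<in> null_sets lebesgue"
    by (rule null_sets_completion_subset[OF _ null_sets_completionI, rotated])
  have split: "S \<times> T = S0 \<times> T0 \<union> (S \<times> T - S0 \<times> T0)" using S0 T0 by auto
  have rect: "S0 \<times> T0 \<in> sets borel" using S0 T0 by (simp add: borel_Times)
  then show "S \<times> T \<in> sets lebesgue"
    using null_setsD2[OF null] by (subst split) (intro sets.Un, auto)
  have "emeasure lebesgue (S \<times> T) = emeasure lebesgue (S0 \<times> T0)"
    using null rect by (subst split) (intro emeasure_Un_null_set, auto)
  also have "\<dots> = emeasure (lborel \<Otimes>\<^sub>M lborel) (S0 \<times> T0)"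
    using rect by (simp add: lborel_prod)
  also have "\<dots> = emeasure lborel S0 * emeasure lborel T0"
    using S0 T0 by (intro lborel.emeasure_pair_measure_Times) auto
  also have "\<dots> = emeasure lebesgue S * emeasure lebesgue T"
    using assms by (simp add: S0_def T0_def emeasure_completion)
  finally show "emeasure lebesgue (S \<times> T) = emeasure lebesgue S * emeasure lebesgue T" .
qed

section \<open>Blocks and overlaps\<close>

lemma block_subset:
  assumes "i \<in> {1..k}"
  shows "block k i \<subseteq> {0..1}"
proof -
  have "0 \<le> (real i - 1) / real k" "real i / real k \<le> 1"
    using assms by (simp_all add: divide_le_eq_1)
  then have "{(real i - 1) / real k <.. real i / real k} \<subseteq> {0..1}" by fastforce
  then show ?thesis by (auto simp: block_def)
qed

lemma sets_block: "block k i \<in> sets lebesgue"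
  by (auto simp: block_def)

lemma emeasure_block:
  assumes "i \<in> {1..k}"
  shows "emeasure lebesgue (block k i) = ennreal (1 / k)"
proof -
  have "emeasure lebesgue (block k i) = emeasure lebesgue {(real i - 1) / real k <.. real i / real k}"
    unfolding block_def by (intro emeasure_Un_null_set) auto
  also have "\<dots> = ennreal (1 / k)"
    using assms by (simp add: divide_right_mono diff_divide_distrib)
  finally show ?thesis .
qed

lemma in_some_block:
  assumes "k > 0" "x \<in> {0..1}"
  obtains i where "i \<in> {1..k}" "x \<in> block k i"
proof (cases "x = 0")
  case True
  then show ?thesis using assms by (intro that[of 1]) (auto simp: block_def)
next
  case False
  define i where "i = nat \<lceil>x * k\<rceil>"
  have pos: "0 < x * k" using False assms by simp
  then have i: "real i = of_int \<lceil>x * k\<rceil>" unfolding i_def by simp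
  have "x * k \<le> k" using assms by (simp add: mult_left_le_one_le)
  then have "\<lceil>x * k\<rceil> \<le> int k" by (simp add: ceiling_le_iff)
  then have "i \<le> k" unfolding i_def by (simp only: nat_le_iff)
  moreover have "0 < real i" using pos unfolding i by simp
  ultimately have "i \<in> {1..k}" by simp
  moreover have "x \<in> block k i"
  proof -
    have "real i - 1 < x * k" "x * k \<le> real i" unfolding i by linarith+
    then show ?thesis using assms by (simp add: block_def divide_simps)
  qed
  ultimately show ?thesis by (rule that)
qed

text \<open>
  The block of \<open>\<phi> x\<close> comes first and the block of \<open>x\<close> second, so that
  for a \<open>\<phi>\<close> that maps each block \<open>j\<close> onto the block \<open>\<sigma> j\<close> the nonempty overlaps are the
  \<open>overlap k \<phi> (\<sigma> j) j\<close>.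
\<close>

definition overlap :: "nat \<Rightarrow> (real \<Rightarrow> real) \<Rightarrow> nat \<Rightarrow> nat \<Rightarrow> real set" where
  "overlap k \<phi> i j = \<phi> -` block k i \<inter> block k j"

lemma measure_preserving_unit_range:
  assumes "measure_preserving_unit \<phi>" "x \<in> {0..1}"
  shows "\<phi> x \<in> {0..1}"
proof -
  have "\<phi> \<in> measurable (lebesgue_on {0..1}) (lebesgue_on {0..1})"
    using assms(1) by (simp add: measure_preserving_unit_def)
  from measurable_space[OF this] show ?thesis using assms(2) by auto
qed

lemma preimage_block:
  assumes "measure_preserving_unit \<phi>" "i \<in> {1..k}"
  shows "\<phi> -` block k i \<inter> {0..1} \<in> sets lebesgue"
    and "emeasure lebesgue (\<phi> -` block k i \<inter> {0..1}) = ennreal (1 / k)"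
proof -
  have I: "block k i \<in> sets (lebesgue_on {0..1})"
    using sets_block block_subset[OF assms(2)] by (auto simp: sets_restrict_space_iff)
  have \<phi>: "\<phi> \<in> measurable (lebesgue_on {0..1}) (lebesgue_on {0..1})"
    using assms(1) by (simp add: measure_preserving_unit_def)
  have "\<phi> -` block k i \<inter> {0..1} \<in> sets (lebesgue_on {0..1})"
    using measurable_sets[OF \<phi> I] by simp
  then show S: "\<phi> -` block k i \<inter> {0..1} \<in> sets lebesgue"
    by (simp add: sets_restrict_space_iff)
  have "emeasure (lebesgue_on {0..1}) (\<phi> -` block k i \<inter> {0..1})
      = emeasure (lebesgue_on {0..1}) (block k i)"
    using assms(1) I by (simp add: measure_preserving_unit_def)
  then show "emeasure lebesgue (\<phi> -` block k i \<inter> {0..1}) = ennreal (1 / k)"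
    using block_subset[OF assms(2)] emeasure_block[OF assms(2)]
    by (simp add: emeasure_restrict_space)
qed

lemma overlap_lmeasurable:
  assumes "measure_preserving_unit \<phi>" "i \<in> {1..k}" "j \<in> {1..k}"
  shows "overlap k \<phi> i j \<in> lmeasurable"
proof -
  have "overlap k \<phi> i j = (\<phi> -` block k i \<inter> {0..1}) \<inter> block k j"
    using block_subset[OF assms(3)] by (auto simp: overlap_def)
  moreover have "block k j \<in> lmeasurable"
    using emeasure_block[OF assms(3)] sets_block by (intro fmeasurableI) auto
  ultimately show ?thesis
    using preimage_block(1)[OF assms(1,2)] by (simp add: fmeasurable_Int_fmeasurable Int_commute)
qed

lemma sum_measure_overlap:
  assumes "measure_preserving_unit \<phi>" "k > 0"
  shows "i \<in> {1..k} \<Longrightarrow> (\<Sum>j=1..k. measure lebesgue (overlap k \<phi> i j)) = 1 / k"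
    and "j \<in> {1..k} \<Longrightarrow> (\<Sum>i=1..k. measure lebesgue (overlap k \<phi> i j)) = 1 / k"
proof -
  have disj: "disjoint_family_on (\<lambda>j. overlap k \<phi> i j) {1..k}"
    "disjoint_family_on (\<lambda>i. overlap k \<phi> i j) {1..k}" for i j
    by (auto simp: disjoint_family_on_def overlap_def dest: block_unique)
  have fm: "overlap k \<phi> i j \<in> lmeasurable" if "i \<in> {1..k}" "j \<in> {1..k}" for i j
    using overlap_lmeasurable assms(1) that by blast
  {
    assume i: "i \<in> {1..k}"
    have "(\<Sum>j=1..k. measure lebesgue (overlap k \<phi> i j))
        = measure lebesgue (\<Union>j\<in>{1..k}. overlap k \<phi> i j)"
    proof (rule measure_finite_Union[symmetric])
      show "emeasure lebesgue (overlap k \<phi> i j) \<noteq> \<infinity>" if "j \<in> {1..k}" for j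
        using fmeasurableD2[OF fm] i that unfolding infinity_ennreal_def by blast
      show "(\<lambda>j. overlap k \<phi> i j) ` {1..k} \<subseteq> sets lebesgue"
        using fmeasurableD[OF fm] i by blast
    qed (simp, rule disj)
    also have "(\<Union>j\<in>{1..k}. overlap k \<phi> i j) = \<phi> -` block k i \<inter> {0..1}"
    proof
      show "\<phi> -` block k i \<inter> {0..1} \<subseteq> (\<Union>j\<in>{1..k}. overlap k \<phi> i j)"
      proof
        fix x assume x: "x \<in> \<phi> -` block k i \<inter> {0..1}"
        then obtain j where "j \<in> {1..k}" "x \<in> block k j" using in_some_block[OF assms(2)] by blast
        then show "x \<in> (\<Union>j\<in>{1..k}. overlap k \<phi> i j)" using x by (auto simp: overlap_def)
      qed
      show "(\<Union>j\<in>{1..k}. overlap k \<phi> i j) \<subseteq> \<phi> -` block k i \<inter> {0..1}"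
        using block_subset unfolding overlap_def by blast
    qed
    also have "measure lebesgue \<dots> = 1 / k"
      using preimage_block(2)[OF assms(1) i] by (simp add: measure_def)
    finally show "(\<Sum>j=1..k. measure lebesgue (overlap k \<phi> i j)) = 1 / k" .
  next
    assume j: "j \<in> {1..k}"
    have "(\<Sum>i=1..k. measure lebesgue (overlap k \<phi> i j))
        = measure lebesgue (\<Union>i\<in>{1..k}. overlap k \<phi> i j)"
    proof (rule measure_finite_Union[symmetric])
      show "emeasure lebesgue (overlap k \<phi> i j) \<noteq> \<infinity>" if "i \<in> {1..k}" for i
        using fmeasurableD2[OF fm] j that unfolding infinity_ennreal_def by blast
      show "(\<lambda>i. overlap k \<phi> i j) ` {1..k} \<subseteq> sets lebesgue"
        using fmeasurableD[OF fm] j by blast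
    qed (simp, rule disj)
    also have "(\<Union>i\<in>{1..k}. overlap k \<phi> i j) = block k j"
    proof
      show "block k j \<subseteq> (\<Union>i\<in>{1..k}. overlap k \<phi> i j)"
      proof
        fix x assume x: "x \<in> block k j"
        then have "\<phi> x \<in> {0..1}"
          using block_subset[OF j] measure_preserving_unit_range[OF assms(1)] by blast
        then obtain i where "i \<in> {1..k}" "\<phi> x \<in> block k i" using in_some_block[OF assms(2)] by blast
        then show "x \<in> (\<Union>i\<in>{1..k}. overlap k \<phi> i j)" using x by (auto simp: overlap_def)
      qed
    qed (auto simp: overlap_def)
    also have "measure lebesgue \<dots> = 1 / k"
      using emeasure_block[OF j] by (simp add: measure_def)
    finally show "(\<Sum>i=1..k. measure lebesgue (overlap k \<phi> i j)) = 1 / k" .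
  }
qed

text \<open>
  The integrand is constant on each product of two overlaps, and these products partition
  the unit square.
\<close>

lemma L2_norm_square_block_diff:
  assumes "measure_preserving_unit \<phi>" "k > 0"
  shows "L2_norm_square (\<lambda>x y. relabel \<phi> (block_function k A) x y - block_function k B x y) =
    sqrt (\<Sum>j'=1..k. \<Sum>i'=1..k. \<Sum>j=1..k. \<Sum>i=1..k. (A i i' - B j j')\<^sup>2 *
      measure lebesgue (overlap k \<phi> i j) * measure lebesgue (overlap k \<phi> i' j'))"
proof -
  let ?X = "{1..k}"
  let ?E = "overlap k \<phi>"
  let ?Q = "{0..1} \<times> {0..1} :: (real \<times> real) set"
  define f where "f x y = relabel \<phi> (block_function k A) x y - block_function k B x y" for x y
  define g :: "real \<times> real \<Rightarrow> real" where
    "g p = (\<Sum>j'\<in>?X. \<Sum>i'\<in>?X. \<Sum>j\<in>?X. \<Sum>i\<in>?X.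
      (A i i' - B j j')\<^sup>2 * indicator (?E i j \<times> ?E i' j') p)" for p
  have fg: "(f x y)\<^sup>2 * indicator ?Q (x, y) = g (x, y)" for x y
  proof (cases "(x, y) \<in> ?Q")
    case True
    then have x: "x \<in> {0..1}" and y: "y \<in> {0..1}" by auto
    obtain j where j: "j \<in> ?X" "x \<in> block k j" using in_some_block[OF assms(2) x] .
    obtain j' where j': "j' \<in> ?X" "y \<in> block k j'" using in_some_block[OF assms(2) y] .
    obtain i where i: "i \<in> ?X" "\<phi> x \<in> block k i"
      using in_some_block[OF assms(2) measure_preserving_unit_range[OF assms(1) x]] .
    obtain i' where i': "i' \<in> ?X" "\<phi> y \<in> block k i'"
      using in_some_block[OF assms(2) measure_preserving_unit_range[OF assms(1) y]] .
    have "g (x, y) = (\<Sum>b'\<in>?X. \<Sum>a'\<in>?X. \<Sum>b\<in>?X. \<Sum>a\<in>?X.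
        if a = i then if b = j then if a' = i' then if b' = j' then (A a a' - B b b')\<^sup>2
        else 0 else 0 else 0 else 0)"
      unfolding g_def
    proof (intro sum.cong refl)
      fix b' a' b a assume ab: "b' \<in> ?X" "a' \<in> ?X" "b \<in> ?X" "a \<in> ?X"
      have "\<phi> x \<in> block k a \<longleftrightarrow> a = i" "x \<in> block k b \<longleftrightarrow> b = j"
        "\<phi> y \<in> block k a' \<longleftrightarrow> a' = i'" "y \<in> block k b' \<longleftrightarrow> b' = j'"
        using i j i' j' ab block_unique by blast+
      then show "(A a a' - B b b')\<^sup>2 * indicator (?E a b \<times> ?E a' b') (x, y) =
        (if a = i then if b = j then if a' = i' then if b' = j' then (A a a' - B b b')\<^sup>2
        else 0 else 0 else 0 else 0)"
        by (auto simp: overlap_def indicator_def)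
    qed
    also have "\<dots> = (\<Sum>b'\<in>?X. \<Sum>a'\<in>?X. if a' = i' then if b' = j' then (A i a' - B j b')\<^sup>2
        else 0 else 0)"
      using i j by (simp add: sum.delta)
    also have "\<dots> = (A i i' - B j j')\<^sup>2"
      using i' j' by (simp add: sum.delta)
    finally show ?thesis
      using True i j i' j' by (simp add: f_def relabel_def block_function_eq)
  next
    case False
    have "(x, y) \<notin> ?E i j \<times> ?E i' j'" if "i \<in> ?X" "j \<in> ?X" "i' \<in> ?X" "j' \<in> ?X" for i j i' j'
      using False block_subset[OF that(2)] block_subset[OF that(4)] by (auto simp: overlap_def)
    then have "g (x, y) = 0" unfolding g_def by (intro sum.neutral ballI) auto
    then show ?thesis using False by simp
  qed
  have rect: "?E i j \<times> ?E i' j' \<in> sets lebesgue"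
    "emeasure lebesgue (?E i j \<times> ?E i' j') =
      ennreal (measure lebesgue (?E i j) * measure lebesgue (?E i' j'))"
    if "i \<in> ?X" "j \<in> ?X" "i' \<in> ?X" "j' \<in> ?X" for i j i' j'
  proof -
    have E: "?E i j \<in> lmeasurable" "?E i' j' \<in> lmeasurable"
      using overlap_lmeasurable[OF assms(1)] that by auto
    then show "?E i j \<times> ?E i' j' \<in> sets lebesgue"
      by (intro sets_lebesgue_Times) auto
    show "emeasure lebesgue (?E i j \<times> ?E i' j') =
        ennreal (measure lebesgue (?E i j) * measure lebesgue (?E i' j'))"
      using E by (subst emeasure_lebesgue_Times)
        (auto simp: emeasure_eq_measure2 fmeasurableD ennreal_mult)
  qed
  have ind: "has_bochner_integral lebesgue (indicator (?E i j \<times> ?E i' j') :: _ \<Rightarrow> real)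
      (measure lebesgue (?E i j) * measure lebesgue (?E i' j'))"
    if "i \<in> ?X" "j \<in> ?X" "i' \<in> ?X" "j' \<in> ?X" for i j i' j'
  proof -
    have "measure lebesgue (?E i j \<times> ?E i' j') = measure lebesgue (?E i j) * measure lebesgue (?E i' j')"
      using rect(2)[OF that] by (simp add: measure_def[of _ "_ \<times> _"])
    then show ?thesis
      using has_bochner_integral_real_indicator[OF rect(1)[OF that]] rect(2)[OF that] by simp
  qed
  have "has_bochner_integral lebesgue g
    (\<Sum>j'\<in>?X. \<Sum>i'\<in>?X. \<Sum>j\<in>?X. \<Sum>i\<in>?X. (A i i' - B j j')\<^sup>2 *
      (measure lebesgue (?E i j) * measure lebesgue (?E i' j')))"
    unfolding g_def
    by (intro has_bochner_integral_sum has_bochner_integral_mult_right ind) auto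
  then have "integral\<^sup>L lebesgue g =
    (\<Sum>j'\<in>?X. \<Sum>i'\<in>?X. \<Sum>j\<in>?X. \<Sum>i\<in>?X. (A i i' - B j j')\<^sup>2 *
      measure lebesgue (?E i j) * measure lebesgue (?E i' j'))"
    by (simp add: has_bochner_integral_integral_eq mult.assoc)
  moreover have "integral\<^sup>L (lebesgue_on ?Q) (\<lambda>(x, y). (f x y)\<^sup>2) = integral\<^sup>L lebesgue g"
  proof -
    have "?Q \<in> sets lebesgue" by (intro sets_lebesgue_Times) auto
    then have "integral\<^sup>L (lebesgue_on ?Q) (\<lambda>(x, y). (f x y)\<^sup>2)
        = integral\<^sup>L lebesgue (\<lambda>p. indicator ?Q p *\<^sub>R (case p of (x, y) \<Rightarrow> (f x y)\<^sup>2))"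
      by (intro integral_restrict_space) auto
    also have "(\<lambda>p. indicator ?Q p *\<^sub>R (case p of (x, y) \<Rightarrow> (f x y)\<^sup>2)) = g"
      by (rule ext) (auto simp: fg[symmetric] mult.commute)
    finally show ?thesis .
  qed
  ultimately show ?thesis
    unfolding L2_norm_square_def f_def by simp
qed

section \<open>Comparison of the two distances\<close>

theorem lemma4:
  fixes k :: nat and A B :: "nat \<Rightarrow> nat \<Rightarrow> real"
  assumes "k > 0"
  shows "delta2_hat_hat k A B \<le> delta2 (block_function k A) (block_function k B)"
  unfolding delta2_def
proof (rule cINF_greatest)
  show "{\<phi>. measure_preserving_unit \<phi>} \<noteq> {}" using measure_preserving_unit_id by blast
  fix \<phi> assume "\<phi> \<in> {\<phi>. measure_preserving_unit \<phi>}"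
  then have \<phi>: "measure_preserving_unit \<phi>" by simp
  let ?X = "{1..k}"
  define P where "P i j = measure lebesgue (overlap k \<phi> i j)" for i j
  note avg = exists_permutation_below_average[of ?X P "1 / k",
      OF _ _ sum_measure_overlap[OF \<phi> assms, folded P_def]]
  \<comment> \<open>The cost of matching \<open>i'\<close> to \<open>j'\<close> while the first argument of the form is still \<open>P\<close>.\<close>
  define c where "c i' j' = (\<Sum>j\<in>?X. \<Sum>i\<in>?X. (A i i' - B j j')\<^sup>2 * P i j)" for i' j'
  obtain \<tau> where \<tau>: "\<tau> permutes ?X"
    "1 / k * (\<Sum>j'\<in>?X. c (\<tau> j') j') \<le> (\<Sum>j'\<in>?X. \<Sum>i'\<in>?X. c i' j' * P i' j')"
    using avg[of c] by (auto simp: P_def)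
  \<comment> \<open>The cost of matching \<open>i\<close> to \<open>j\<close> after the second argument has become \<open>\<tau>\<close>.\<close>
  define d where "d i j = (\<Sum>j'\<in>?X. (A i (\<tau> j') - B j j')\<^sup>2)" for i j
  obtain \<sigma> where \<sigma>: "\<sigma> permutes ?X"
    "1 / k * (\<Sum>j\<in>?X. d (\<sigma> j) j) \<le> (\<Sum>j\<in>?X. \<Sum>i\<in>?X. d i j * P i j)"
    using avg[of d] by (auto simp: P_def)
  have cd: "(\<Sum>j'\<in>?X. c (\<tau> j') j') = (\<Sum>j\<in>?X. \<Sum>i\<in>?X. d i j * P i j)"
  proof -
    have "(\<Sum>j'\<in>?X. c (\<tau> j') j') =
        (\<Sum>j\<in>?X. \<Sum>j'\<in>?X. \<Sum>i\<in>?X. (A i (\<tau> j') - B j j')\<^sup>2 * P i j)"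
      unfolding c_def by (rule sum.swap)
    also have "\<dots> = (\<Sum>j\<in>?X. \<Sum>i\<in>?X. \<Sum>j'\<in>?X. (A i (\<tau> j') - B j j')\<^sup>2 * P i j)"
      by (intro sum.cong refl sum.swap)
    finally show ?thesis by (simp add: d_def sum_distrib_right)
  qed
  have "delta2_hat_hat k A B \<le> matrix_norm2 k (\<lambda>i j. permute_matrix \<sigma> \<tau> A i j - B i j)"
    unfolding delta2_hat_hat_def
    by (rule Min_le[OF delta2_hat_hat_set(1)]) (use \<sigma>(1) \<tau>(1) in blast)
  also have "\<dots> = sqrt (1 / k * (1 / k * (\<Sum>j\<in>?X. d (\<sigma> j) j)))"
    by (simp add: matrix_norm2_def permute_matrix_def d_def power2_eq_square)
  also have "\<dots> \<le> sqrt (1 / k * (\<Sum>j'\<in>?X. c (\<tau> j') j'))"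
    unfolding cd using \<sigma>(2) by (intro real_sqrt_le_mono mult_left_mono) auto
  also have "\<dots> \<le> sqrt (\<Sum>j'\<in>?X. \<Sum>i'\<in>?X. c i' j' * P i' j')"
    using \<tau>(2) by (rule real_sqrt_le_mono)
  also have "\<dots> = L2_norm_square
      (\<lambda>x y. relabel \<phi> (block_function k A) x y - block_function k B x y)"
    unfolding L2_norm_square_block_diff[OF \<phi> assms] by (simp add: c_def P_def sum_distrib_right)
  finally show "delta2_hat_hat k A B \<le> L2_norm_square
      (\<lambda>x y. relabel \<phi> (block_function k A) x y - block_function k B x y)" .
qed

end
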